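(* The solution of the Karush–Kuhn–Tucker conditions of the problem $P_1(\theta)$, for $\theta\in[0,\tau]$, can be found by the pair $(\boldsymbol{x}(\theta),\boldsymbol{\lambda})$ which follows the dynamical system $$\dot{\boldsymbol{x}}_m(\theta)=\boldsymbol{\phi}_m\big(\boldsymbol{x}(\theta),\theta\big),\qquad m\in\{1,\ldots,M\},$$ with $$\boldsymbol{\phi}_m\big(\boldsymbol{x}(\theta),\theta\big)=-\Big(b_m(\theta)\nabla_m^2 f+\sum_{n=1}^N\lambda_n\nabla_m^2 h_{m,n}\Big)^{-1}\boldsymbol{\mathcal{J}}_m\Big(\dot{\boldsymbol{\lambda}}-\frac{\dot b_m(\theta)}{b_m(\theta)}\boldsymbol{\lambda}\Big),$$ where $$\boldsymbol{\lambda}=-b_m(\theta)\,\boldsymbol{\mathcal{J}}_m^{-1}\nabla_m f\qquad\text{for } m\in\{1,\ldots,M\},$$ and $\dot{\boldsymbol{\lambda}}$ is obtained using $$\sum_{m=1}^M\boldsymbol{\mathcal{J}}_m^\top\,\dot{\boldsymbol{x}}_m(\theta)=\boldsymbol{0}.$$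
   Context: $N,M$ are positive integers, $\tau>0$ and $\boldsymbol{u}\in\mathbb{R}^N$. Given are an objective function $f:\mathbb{R}^N\to\mathbb{R}$ and constraint functions $\boldsymbol{h}_m=[h_{m,1},\ldots,h_{m,N}]^\top:\mathbb{R}^N\to\mathbb{R}^N$, $m\in\{1,\ldots,M\}$. The scalar parametric functions $b_m(\theta)$, $\theta\in\mathbb{R}^+\cup\{0\}$, satisfy $\lim_{\theta\to 0}b_m(\theta)=p_{0,m}$ and $\lim_{\theta\to\tau}b_m(\theta)=p_{\tau,m}$ for given non-zero numbers $p_{0,m},p_{\tau,m}$. The time-varying optimization problem is $$P_1(\theta):\quad \boldsymbol{x}^*(\theta)=\underset{\{\boldsymbol{x}_m(\theta)\}_{m=1}^M}{\mathrm{argmin}}\ \sum_{m=1}^M b_m(\theta)f\big(\boldsymbol{x}_m(\theta)\big)\quad\text{s.t.}\quad\sum_{m=1}^M\boldsymbol{h}_m\big(\boldsymbol{x}_m(\theta)\big)=\boldsymbol{u},$$ with $\boldsymbol{x}_m(\theta)\in\mathbb{R}^N$ and $\boldsymbol{x}(\theta)=[\boldsymbol{x}_1^\top,\ldots,\boldsymbol{x}_M^\top]^\top(\theta)\in\mathbb{R}^{NM}$. The solution of $P_1(0)$ is assumed given, and the dynamical system is to be solved with the initial condition $\boldsymbol{x}(0)$ to give the target point $\boldsymbol{x}(\tau)$. Notation: a dot denotes the derivative with respect to $\theta$; $\boldsymbol{\lambda}=[\lambda_1,\ldots,\lambda_N]^\top$ is the Lagrange multiplier of the constraint; $\nabla_m$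 and $\nabla_m^2$ denote gradient and Hessian with respect to $\boldsymbol{x}_m$, with $f$ and $h_{m,n}$ evaluated at $\boldsymbol{x}_m(\theta)$; $\boldsymbol{\mathcal{J}}_m\in\mathbb{R}^{N\times N}$ is the transpose of the Jacobian matrix of $\boldsymbol{h}_m$ with respect to $\boldsymbol{x}_m(\theta)$. The Karush–Kuhn–Tucker conditions of $P_1(\theta)$ are $b_m(\theta)\nabla_m f+\boldsymbol{\mathcal{J}}_m\boldsymbol{\lambda}=\boldsymbol{0}$ for all $m$ and $\sum_{m=1}^M\boldsymbol{h}_m(\boldsymbol{x}_m)=\boldsymbol{u}$. Standing assumptions: $f$ and all $\boldsymbol{h}_m$ are twice continuously differentiable with respect to $\boldsymbol{x}_m$; the matrices $\boldsymbol{\mathcal{J}}_1,\ldots,\boldsymbol{\mathcal{J}}_M$ are invertible for $\theta\in[0,\tau]$. *)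

theory Defs
  imports "HOL-Analysis.Analysis"
begin

text \<open>
  The index type \<open>'n\<close> has \<open>N\<close> elements and \<open>'m\<close> has \<open>M\<close> elements. A stacked vector of
  \<open>\<real>\<^sup>N\<^sup>M\<close> has type \<open>real^'n^'m\<close>; its block \<open>m\<close> is \<open>x $ m\<close>.
\<close>

definition grad :: "(real^'n \<Rightarrow> real) \<Rightarrow> real^'n \<Rightarrow> real^'n" where
  "grad g y = (\<chi> i. frechet_derivative g (at y) (axis i 1))"

definition hess :: "(real^'n \<Rightarrow> real) \<Rightarrow> real^'n \<Rightarrow> real^'n^'n" where
  "hess g y = jacobian (grad g) (at y)"

definition twice_cont_diff :: "(real^'n \<Rightarrow> real) \<Rightarrow> bool" where
  "twice_cont_diff g \<longleftrightarrow>
     (\<forall>y. g differentiable (at y)) \<and> (\<forall>y. grad g differentiable (at y)) \<and>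
     continuous_on UNIV (hess g)"

definition Jt :: "(real^'n \<Rightarrow> real^'n) \<Rightarrow> real^'n \<Rightarrow> real^'n^'n" where
  "Jt g y = transpose (jacobian g (at y))"

text \<open>The derivative with respect to \<open>\<theta>\<close> on \<open>[0,\<tau>]\<close>, one-sided at the two endpoints.\<close>

definition dot :: "real \<Rightarrow> (real \<Rightarrow> 'a::real_normed_vector) \<Rightarrow> real \<Rightarrow> 'a" where
  "dot \<tau> g \<theta> = vector_derivative g (at \<theta> within {0..\<tau>})"

definition solves_P1 ::
  "(real^'n \<Rightarrow> real) \<Rightarrow> ('m \<Rightarrow> real^'n \<Rightarrow> real^'n) \<Rightarrow> ('m \<Rightarrow> real \<Rightarrow> real) \<Rightarrow> real^'n \<Rightarrow> real
    \<Rightarrow> real^'n^'m \<Rightarrow> bool" where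
  "solves_P1 f h b u \<theta> x \<longleftrightarrow>
     is_arg_min (\<lambda>z. \<Sum>m\<in>UNIV. b m \<theta> * f (z $ m)) (\<lambda>z. (\<Sum>m\<in>UNIV. h m (z $ m)) = u) x"

definition KKT ::
  "(real^'n \<Rightarrow> real) \<Rightarrow> ('m \<Rightarrow> real^'n \<Rightarrow> real^'n) \<Rightarrow> ('m \<Rightarrow> real \<Rightarrow> real) \<Rightarrow> real^'n \<Rightarrow> real
    \<Rightarrow> real^'n^'m \<Rightarrow> real^'n \<Rightarrow> bool" where
  "KKT f h b u \<theta> x lam \<longleftrightarrow>
     (\<forall>m. b m \<theta> *\<^sub>R grad f (x $ m) + Jt (h m) (x $ m) *v lam = 0) \<and>
     (\<Sum>m\<in>UNIV. h m (x $ m)) = u"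

definition HL ::
  "(real^'n \<Rightarrow> real) \<Rightarrow> ('m \<Rightarrow> real^'n \<Rightarrow> real^'n) \<Rightarrow> ('m \<Rightarrow> real \<Rightarrow> real) \<Rightarrow> real
    \<Rightarrow> real^'n^'m \<Rightarrow> real^'n \<Rightarrow> 'm \<Rightarrow> real^'n^'n" where
  "HL f h b \<theta> x lam m =
     b m \<theta> *\<^sub>R hess f (x $ m) + (\<Sum>n\<in>UNIV. lam $ n *\<^sub>R hess (\<lambda>y. h m y $ n) (x $ m))"

definition phi ::
  "real \<Rightarrow> (real^'n \<Rightarrow> real) \<Rightarrow> ('m \<Rightarrow> real^'n \<Rightarrow> real^'n) \<Rightarrow> ('m \<Rightarrow> real \<Rightarrow> real) \<Rightarrow> real
    \<Rightarrow> real^'n^'m \<Rightarrow> real^'n \<Rightarrow> real^'n \<Rightarrow> 'm \<Rightarrow> real^'n" where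
  "phi \<tau> f h b \<theta> x lam lamdot m =
     - (matrix_inv (HL f h b \<theta> x lam m) *v
         (Jt (h m) (x $ m) *v (lamdot - (dot \<tau> (b m) \<theta> / b m \<theta>) *\<^sub>R lam)))"

definition multiplier ::
  "(real^'n \<Rightarrow> real) \<Rightarrow> ('m \<Rightarrow> real^'n \<Rightarrow> real^'n) \<Rightarrow> ('m \<Rightarrow> real \<Rightarrow> real) \<Rightarrow> real
    \<Rightarrow> real^'n^'m \<Rightarrow> 'm \<Rightarrow> real^'n" where
  "multiplier f h b \<theta> x m = - (b m \<theta> *\<^sub>R (matrix_inv (Jt (h m) (x $ m)) *v grad f (x $ m)))"

text \<open>
  The system as it is integrated: \<open>lam\<close> is evaluated from the current state by the formula
  of one index \<open>k\<close>, and \<open>lamdot\<close> is any function that makes the last equation hold.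
  Neither the formulas for the other indices nor that \<open>lamdot\<close> is the derivative of \<open>lam\<close>
  is part of the predicate.
\<close>

definition follows_system ::
  "real \<Rightarrow> (real^'n \<Rightarrow> real) \<Rightarrow> ('m \<Rightarrow> real^'n \<Rightarrow> real^'n) \<Rightarrow> ('m \<Rightarrow> real \<Rightarrow> real) \<Rightarrow> 'm
    \<Rightarrow> (real \<Rightarrow> real^'n^'m) \<Rightarrow> (real \<Rightarrow> real^'n) \<Rightarrow> (real \<Rightarrow> real^'n) \<Rightarrow> bool" where
  "follows_system \<tau> f h b k x lam lamdot \<longleftrightarrow>
     (\<forall>\<theta>\<in>{0..\<tau>}.
        (\<forall>m. ((\<lambda>t. x t $ m) has_vector_derivative phi \<tau> f h b \<theta> (x \<theta>) (lam \<theta>) (lamdot \<theta>) m)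
               (at \<theta> within {0..\<tau>})) \<and>
        lam \<theta> = multiplier f h b \<theta> (x \<theta>) k \<and>
        (\<Sum>m\<in>UNIV. transpose (Jt (h m) (x \<theta> $ m)) *v dot \<tau> (\<lambda>t. x t $ m) \<theta>) = 0)"

end

theory Submission
  imports Defs
begin

text \<open>
  Let \<open>r\<^sub>m = b\<^sub>m \<nabla>f(x\<^sub>m) + J\<^sub>m \<lambda>\<close> be the stationarity residual. The velocity formula
  says exactly that formally differentiating \<open>r\<^sub>m\<close>, with the given \<open>lamdot\<close> as the derivative
  of \<open>\<lambda>\<close>, yields \<open>(b\<^sub>m'/b\<^sub>m) r\<^sub>m\<close>. The multiplier formula of the index \<open>k\<close> gives \<open>r\<^sub>k = 0\<close>;
  comparing the true derivative of \<open>r\<^sub>k\<close> with the formal one and cancelling \<open>J\<^sub>k\<close> shows that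
  \<open>lamdot\<close> is the derivative of \<open>\<lambda>\<close>. Hence \<open>r\<^sub>m / b\<^sub>m\<close> is constant for every \<open>m\<close>, and it vanishes
  at \<open>0\<close> by the initial condition. Conversely, \<open>r\<^sub>m = 0\<close> on \<open>[0,\<tau>]\<close> can be differentiated and
  solved for the velocity. A minimizer satisfies the conditions because a move of one block can
  be compensated in the constraint by another block, by the inverse function theorem.
\<close>

section \<open>Inverse matrices and smooth dependence of solutions of linear systems\<close>

lemma invertible_matrix_inv:
  fixes A :: "real^'n^'n"
  assumes "invertible A"
  shows "A ** matrix_inv A = mat 1" "matrix_inv A ** A = mat 1"
proof -
  have "A ** matrix_inv A = mat 1 \<and> matrix_inv A ** A = mat 1"
    using assms unfolding invertible_def matrix_inv_def by (rule someI_ex)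
  then show "A ** matrix_inv A = mat 1" "matrix_inv A ** A = mat 1" by auto
qed

lemma invertible_mult_eq_iff:
  fixes A :: "real^'n^'n"
  assumes "invertible A"
  shows "A *v v = w \<longleftrightarrow> v = matrix_inv A *v w"
  using invertible_matrix_inv[OF assms]
  by (metis matrix_vector_mul_assoc matrix_vector_mul_lid)

lemma vec_eq_sum_axis: "v = (\<Sum>i\<in>UNIV. v $ i *\<^sub>R axis i 1)" for v :: "real^'n"
  using basis_expansion[of v] by (simp add: scalar_mult_eq_scaleR)

lemma differentiable_vecI:
  fixes F :: "'a::real_normed_vector \<Rightarrow> real^'n"
  assumes "\<And>i. (\<lambda>y. F y $ i) differentiable (at y within S)"
  shows "F differentiable (at y within S)"
proof -
  have "(\<lambda>y. \<Sum>i\<in>UNIV. F y $ i *\<^sub>R axis i (1::real)) differentiable (at y within S)"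
    using assms by (intro differentiable_sum differentiable_scaleR) auto
  then show ?thesis by (simp only: vec_eq_sum_axis[symmetric])
qed

lemma differentiable_prod:
  fixes F :: "'i \<Rightarrow> 'a::real_normed_vector \<Rightarrow> real"
  assumes "\<And>i. i \<in> I \<Longrightarrow> F i differentiable (at y within S)"
  shows "(\<lambda>y. \<Prod>i\<in>I. F i y) differentiable (at y within S)"
proof -
  obtain F' where "\<And>i. i \<in> I \<Longrightarrow> (F i has_derivative F' i) (at y within S)"
    using assms unfolding differentiable_def by metis
  then show ?thesis unfolding differentiable_def by (blast intro: has_derivative_prod)
qed

lemma differentiable_det:
  fixes A :: "'a::real_normed_vector \<Rightarrow> real^'n^'n"
  assumes "\<And>i j. (\<lambda>y. A y $ i $ j) differentiable (at y within S)"
  shows "(\<lambda>y. det (A y)) differentiable (at y within S)"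
  unfolding det_def using assms
  by (intro differentiable_sum) (auto intro!: differentiable_mult differentiable_prod)

text \<open>By Cramer's rule each component of \<open>v\<close> is a quotient of determinants, which
  are polynomials in the entries of \<open>A\<close> and \<open>c\<close>. Thus \<open>v\<close>
  inherits differentiability without differentiating a matrix inverse.\<close>

lemma differentiable_linear_solution:
  fixes A :: "'a::real_normed_vector \<Rightarrow> real^'n^'n" and v c :: "'a \<Rightarrow> real^'n"
  assumes A: "\<And>i j. (\<lambda>y. A y $ i $ j) differentiable (at y within S)"
    and c: "\<And>i. (\<lambda>y. c y $ i) differentiable (at y within S)"
    and inv: "\<And>y. y \<in> S \<Longrightarrow> invertible (A y)"
    and eq: "\<And>y. y \<in> S \<Longrightarrow> A y *v v y = c y"
    and y: "y \<in> S"
  shows "v differentiable (at y within S)"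
proof (rule differentiable_vecI)
  fix k
  define B where "B z = (\<chi> i j. if j = k then c z $ i else A z $ i $ j)" for z
  have nz: "det (A z) \<noteq> 0" if "z \<in> S" for z
    using inv[OF that] by (simp add: invertible_det_nz)
  have "(\<lambda>z. B z $ i $ j) differentiable (at y within S)" for i j
    using A c by (cases "j = k") (simp_all add: B_def)
  then have "(\<lambda>z. det (B z) / det (A z)) differentiable (at y within S)"
    using nz[OF y] A by (intro differentiable_divide differentiable_det)
  moreover have "det (B z) / det (A z) = v z $ k" if "z \<in> S" for z
    using cramer[OF nz[OF that], of "v z" "c z"] eq[OF that] by (simp add: B_def)
  \<comment> \<open>The quotient equals the component only on \<open>S\<close>, so the transfer is
    made within \<open>S\<close>; the radius 1 is arbitrary.\<close>
  ultimately show "(\<lambda>z. v z $ k) differentiable (at y within S)"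
    using y by (auto intro: differentiable_transform_within[OF _ zero_less_one])
qed

section \<open>Gradients, Hessians and Jacobians along a curve\<close>

lemma has_derivative_grad:
  assumes "g differentiable (at y)"
  shows "(g has_derivative (\<lambda>v. grad g y \<bullet> v)) (at y)"
proof -
  let ?D = "frechet_derivative g (at y)"
  have D: "(g has_derivative ?D) (at y)"
    using assms by (simp add: frechet_derivative_works)
  interpret bounded_linear ?D using D by (rule has_derivative_bounded_linear)
  have "?D v = grad g y \<bullet> v" for v
  proof -
    have "?D v = ?D (\<Sum>i\<in>UNIV. v $ i *\<^sub>R axis i 1)" by (simp only: vec_eq_sum_axis[symmetric])
    then show ?thesis by (simp add: sum scaleR grad_def inner_vec_def mult.commute)
  qed
  then show ?thesis using D by (metis ext)
qed

lemma has_vector_derivative_compose: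
  assumes "(X has_vector_derivative v) (at t within S)" "(g has_derivative g') (at (X t))"
  shows "((\<lambda>t. g (X t)) has_vector_derivative g' v) (at t within S)"
proof -
  interpret bounded_linear g' using assms(2) by (rule has_derivative_bounded_linear)
  show ?thesis
    using has_derivative_compose[OF assms(1)[unfolded has_vector_derivative_def] assms(2)]
    by (simp add: has_vector_derivative_def scaleR)
qed

lemma has_derivative_grad_hess:
  assumes "twice_cont_diff g"
  shows "(grad g has_derivative (\<lambda>v. hess g y *v v)) (at y)"
  using assms by (simp add: twice_cont_diff_def hess_def jacobian_works)

lemma differentiable_components:
  fixes g :: "real^'n \<Rightarrow> real^'n"
  assumes "\<And>n. twice_cont_diff (\<lambda>y. g y $ n)"
  shows "g differentiable (at y)"
  using assms by (intro differentiable_vecI) (simp add: twice_cont_diff_def)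

lemma has_derivative_Jt:
  assumes "g differentiable (at y)"
  shows "(g has_derivative (\<lambda>v. transpose (Jt g y) *v v)) (at y)"
  using assms by (simp add: Jt_def jacobian_works)

lemma Jt_nth:
  assumes "g differentiable (at y)"
  shows "Jt g y $ i $ n = grad (\<lambda>y. g y $ n) y $ i"
proof -
  have "((\<lambda>y. g y $ n) has_derivative (\<lambda>v. frechet_derivative g (at y) v $ n)) (at y)"
    using assms unfolding frechet_derivative_works
    by (rule bounded_linear.has_derivative[OF bounded_linear_vec_nth])
  then have "frechet_derivative (\<lambda>y. g y $ n) (at y) = (\<lambda>v. frechet_derivative g (at y) v $ n)"
    by (rule frechet_derivative_at[symmetric])
  then show ?thesis
    by (simp add: Jt_def grad_def jacobian_def matrix_def transpose_def)
qed

text \<open>Turns the constraint force into a combination of component gradients. Their derivatives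
  are Hessians, so no derivative of a matrix-valued map has to be handled.\<close>

lemma Jt_mult:
  assumes "g differentiable (at y)"
  shows "Jt g y *v l = (\<Sum>n\<in>UNIV. l $ n *\<^sub>R grad (\<lambda>y. g y $ n) y)"
  by (simp add: vec_eq_iff matrix_vector_mult_def Jt_nth[OF assms] mult.commute)

text \<open>Product and chain rule: each gradient contributes its Hessian applied to
  \<open>v\<close>, and the Hessians weighted by \<open>b m t\<close> and by \<open>lam t\<close>
  add up to \<open>HL\<close>.\<close>

lemma has_vector_derivative_stationarity:
  fixes X :: "real \<Rightarrow> real^'n^'m"
  assumes X: "((\<lambda>t. X t $ m) has_vector_derivative v) (at t within S)"
    and b: "(b m has_vector_derivative b') (at t within S)"
    and l: "(lam has_vector_derivative l') (at t within S)"
    and f: "twice_cont_diff f" and h: "\<And>n. twice_cont_diff (\<lambda>y. h m y $ n)"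
  shows "((\<lambda>t. b m t *\<^sub>R grad f (X t $ m) + Jt (h m) (X t $ m) *v lam t)
    has_vector_derivative
      b' *\<^sub>R grad f (X t $ m) + HL f h b t (X t) (lam t) m *v v + Jt (h m) (X t $ m) *v l')
    (at t within S)"
proof -
  have ln: "((\<lambda>t. lam t $ n) has_vector_derivative l' $ n) (at t within S)" for n
    using bounded_linear.has_vector_derivative[OF bounded_linear_vec_nth l] .
  note G = has_vector_derivative_compose[OF X has_derivative_grad_hess]
  have sumv: "(\<Sum>n\<in>UNIV. A n) *v v = (\<Sum>n\<in>UNIV. A n *v v)" for A :: "'n \<Rightarrow> real^'n^'n"
    by (induction rule: infinite_finite_induct) (auto simp: matrix_vector_mult_add_rdistrib)
  have "((\<lambda>t. b m t *\<^sub>R grad f (X t $ m) + (\<Sum>n\<in>UNIV. lam t $ n *\<^sub>R grad (\<lambda>y. h m y $ n) (X t $ m)))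
    has_vector_derivative
      (b m t *\<^sub>R (hess f (X t $ m) *v v) + b' *\<^sub>R grad f (X t $ m)) +
      (\<Sum>n\<in>UNIV. lam t $ n *\<^sub>R (hess (\<lambda>y. h m y $ n) (X t $ m) *v v)
         + l' $ n *\<^sub>R grad (\<lambda>y. h m y $ n) (X t $ m))) (at t within S)"
    using b ln by (intro has_vector_derivative_add has_vector_derivative_sum
      has_vector_derivative_scaleR G f h) (simp_all add: has_real_derivative_iff_has_vector_derivative)
  then show ?thesis
    by (simp add: Jt_mult[OF differentiable_components[OF h]] HL_def
      matrix_vector_mult_add_rdistrib sumv sum.distrib scaleR_matrix_vector_assoc algebra_simps)
qed

section \<open>The multiplier formula of a single block\<close>

lemma multiplier_eq_iff:
  assumes "invertible (Jt (h m) (x $ m))"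
  shows "b m \<theta> *\<^sub>R grad f (x $ m) + Jt (h m) (x $ m) *v l = 0 \<longleftrightarrow> l = multiplier f h b \<theta> x m"
proof -
  have "b m \<theta> *\<^sub>R grad f (x $ m) + Jt (h m) (x $ m) *v l = 0 \<longleftrightarrow>
      Jt (h m) (x $ m) *v l = - (b m \<theta> *\<^sub>R grad f (x $ m))"
    by (metis add.commute add_eq_0_iff)
  then show ?thesis
    by (simp add: invertible_mult_eq_iff[OF assms] multiplier_def
      linear_neg[OF matrix_vector_mul_linear] linear_scale[OF matrix_vector_mul_linear])
qed

text \<open>The multiplier formula says that \<open>lam\<close> solves a linear system with matrix
  \<open>Jt\<close> whose coefficients are differentiable along the curve. Differentiability of
  \<open>lam\<close> is thereby derived, not assumed.\<close>

lemma multiplier_differentiable: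
  assumes X: "(\<lambda>t. X t $ k) differentiable (at t within S)"
    and b: "b k differentiable (at t within S)"
    and f: "twice_cont_diff f" and h: "\<And>n. twice_cont_diff (\<lambda>y. h k y $ n)"
    and inv: "\<And>t. t \<in> S \<Longrightarrow> invertible (Jt (h k) (X t $ k))"
    and lam: "\<And>t. t \<in> S \<Longrightarrow> lam t = multiplier f h b t (X t) k"
    and t: "t \<in> S"
  shows "lam differentiable (at t within S)"
proof (rule differentiable_linear_solution[where
    A = "\<lambda>t. Jt (h k) (X t $ k)" and c = "\<lambda>t. - (b k t *\<^sub>R grad f (X t $ k))"])
  have nth: "(\<lambda>t. grad g (X t $ k) $ i) differentiable (at t within S)" if "twice_cont_diff g" for g i
  proof -
    obtain D where "((\<lambda>t. X t $ k) has_derivative D) (at t within S)"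
      using X unfolding differentiable_def by blast
    from bounded_linear.has_derivative[OF bounded_linear_vec_nth
        has_derivative_compose[OF this has_derivative_grad_hess[OF that]]]
    show ?thesis by (rule differentiableI)
  qed
  show "(\<lambda>t. Jt (h k) (X t $ k) $ i $ j) differentiable (at t within S)" for i j
    using nth[OF h] by (simp add: Jt_nth[OF differentiable_components[OF h]])
  show "(\<lambda>t. (- (b k t *\<^sub>R grad f (X t $ k))) $ i) differentiable (at t within S)" for i
    using nth[OF f] b by simp
  show "Jt (h k) (X s $ k) *v lam s = - (b k s *\<^sub>R grad f (X s $ k))" if "s \<in> S" for s
    using multiplier_eq_iff[of h k "X s", OF inv[OF that], of b s f "lam s"] lam[OF that]
    by (simp add: add_eq_0_iff)
qed (use inv t in auto)

section \<open>First-order necessary conditions at a minimizer\<close>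

lemma local_right_inverse:
  fixes g :: "real^'n \<Rightarrow> real^'n"
  assumes g: "\<And>n. twice_cont_diff (\<lambda>y. g y $ n)" and inv: "invertible (Jt g a)"
  obtains V k k' where "open V" "g a \<in> V" "k (g a) = a" "\<And>y. y \<in> V \<Longrightarrow> g (k y) = y"
    "(k has_derivative k') (at (g a))" "\<And>v. transpose (Jt g a) *v k' v = v"
proof -
  define G where "G y = Blinfun (\<lambda>v. transpose (Jt g y) *v v)" for y
  have G: "blinfun_apply (G y) = (\<lambda>v. transpose (Jt g y) *v v)" for y
    unfolding G_def by (rule bounded_linear_Blinfun_apply) simp
  have grad: "continuous_on UNIV (grad (\<lambda>y. g y $ n))" for n
    using g[of n] by (simp add: twice_cont_diff_def differentiable_imp_continuous_on
      differentiable_on_def)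
  have cont: "continuous_on UNIV G"
  \<comment> \<open>In finite dimension, continuity in operator norm can be tested vector by vector.
    The entries are then inner products with component gradients, which are continuous because they
    are differentiable.\<close>
  proof (rule continuous_on_blinfun_componentwise)
    fix i :: "real^'n"
    have "continuous_on UNIV (\<lambda>y. \<chi> n. grad (\<lambda>y. g y $ n) y \<bullet> i)"
      using grad by (intro continuous_on_vec_lambda continuous_on_inner continuous_on_const)
    moreover have "blinfun_apply (G y) i = (\<chi> n. grad (\<lambda>y. g y $ n) y \<bullet> i)" for y
      by (simp add: G vec_eq_iff matrix_vector_mult_def transpose_def inner_vec_def
        Jt_nth[OF differentiable_components[OF g]])
    ultimately show "continuous_on UNIV (\<lambda>y. blinfun_apply (G y) i)" by (simp only:)
  qed
  have "bounded_linear ((*v) (matrix_inv (transpose (Jt g a))))" by simp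
  then have "Blinfun ((*v) (matrix_inv (transpose (Jt g a)))) o\<^sub>L G a = id_blinfun"
    using invertible_mult_eq_iff[OF transpose_invertible[OF inv]]
    by (intro blinfun_eqI) (simp add: G bounded_linear_Blinfun_apply del: transpose_matrix_vector, metis)
  from inverse_function_theorem[OF open_UNIV _ cont _ this]
  obtain U V k k' where V: "open V" "a \<in> U" "g a \<in> V" and hom: "homeomorphism U V g k"
    and k: "\<And>y. y \<in> V \<Longrightarrow> (k has_derivative k' y) (at y)"
      "\<And>y. y \<in> V \<Longrightarrow> k' y = inv (blinfun_apply (G (k y)))"
      "\<And>y. y \<in> V \<Longrightarrow> bij (blinfun_apply (G (k y)))"
    using has_derivative_Jt[OF differentiable_components[OF g]] G by (metis UNIV_I)
  have ka: "k (g a) = a" using hom V by (simp add: homeomorphism_def)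
  show thesis
  proof
    show "open V" "g a \<in> V" "k (g a) = a" by fact+
    show "g (k y) = y" if "y \<in> V" for y using hom that by (simp add: homeomorphism_def)
    show "(k has_derivative k' (g a)) (at (g a))" using k V by blast
    show "transpose (Jt g a) *v k' (g a) v = v" for v
      using k(2,3)[OF \<open>g a \<in> V\<close>] surj_f_inv_f[of "blinfun_apply (G a)" v]
      by (simp add: ka G bij_is_surj)
  qed
qed

text \<open>Defining \<open>l\<close> by the formula of one block \<open>k\<close> makes that block
  stationary by construction. For any other block, the objective is differentiated along a feasible
  curve through the minimizer.\<close>

lemma solves_P1_imp_KKT:
  fixes x :: "real^'n^'m::finite"
  assumes f: "\<And>y. f differentiable (at y)" and h: "\<And>m n. twice_cont_diff (\<lambda>y. h m y $ n)"
    and inv: "\<And>m. invertible (Jt (h m) (x $ m))"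
    and sol: "solves_P1 f h b u \<theta> x"
  shows "\<exists>l. KKT f h b u \<theta> x l"
proof -
  \<comment> \<open>Index types are nonempty, so some block \<open>k\<close> exists. If it is the
    only one, the case \<open>m \<noteq> k\<close> is vacuous.\<close>
  fix k :: 'm
  define l where "l = multiplier f h b \<theta> x k"
  have lk: "b k \<theta> *\<^sub>R grad f (x $ k) + Jt (h k) (x $ k) *v l = 0"
    using multiplier_eq_iff[of h k x, OF inv] by (simp add: l_def)
  have feas: "(\<Sum>i\<in>UNIV. h i (x $ i)) = u"
    and opt: "\<And>z. (\<Sum>i\<in>UNIV. h i (z $ i)) = u \<Longrightarrow>
      (\<Sum>i\<in>UNIV. b i \<theta> * f (x $ i)) \<le> (\<Sum>i\<in>UNIV. b i \<theta> * f (z $ i))"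
    using sol by (auto simp: solves_P1_def is_arg_min_linorder)
  obtain V q q' where V: "open V" "h k (x $ k) \<in> V" "q (h k (x $ k)) = x $ k"
    and q: "\<And>y. y \<in> V \<Longrightarrow> h k (q y) = y" "(q has_derivative q') (at (h k (x $ k)))"
      "\<And>v. transpose (Jt (h k) (x $ k)) *v q' v = v"
    using local_right_inverse[OF h inv] by metis
  have dh: "(h i has_derivative (\<lambda>v. transpose (Jt (h i) y) *v v)) (at y)" for i y
    by (rule has_derivative_Jt[OF differentiable_components[OF h]])
  have "b m \<theta> *\<^sub>R grad f (x $ m) + Jt (h m) (x $ m) *v l = 0" for m
  proof (cases "m = k")
    case False
    have "(b m \<theta> *\<^sub>R grad f (x $ m) + Jt (h m) (x $ m) *v l) \<bullet> v = 0" for v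
    proof -
      \<comment> \<open>Move block \<open>m\<close> in direction \<open>v\<close>; block \<open>k\<close> restores the constraint.\<close>
      define r where "r t = h k (x $ k) + h m (x $ m) - h m (x $ m + t *\<^sub>R v)" for t
      define Z where "Z t = (\<chi> i. if i = k then q (r t) else if i = m then x $ m + t *\<^sub>R v else x $ i)" for t
      \<comment> \<open>By the chain rule, \<open>w\<close> is the velocity at 0 of the compensating
        block \<open>q (r t)\<close>, and \<open>W\<close> collects the velocities of all
        blocks.\<close>
      define w where "w = q' (- (transpose (Jt (h m) (x $ m)) *v v))"
      define W where "W i = (if i = k then w else if i = m then v else 0)" for i
      have line: "((\<lambda>t. x $ m + t *\<^sub>R v) has_vector_derivative v) (at t)" for t
        by (auto intro!: derivative_eq_intros)
      have dr: "(r has_vector_derivative - (transpose (Jt (h m) (x $ m + t *\<^sub>R v)) *v v)) (at t)" for t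
        unfolding r_def
        by (rule derivative_eq_intros has_vector_derivative_compose[OF line dh] refl)+ simp
      have r0: "r 0 = h k (x $ k)" by (simp add: r_def)
      have "((\<lambda>t. q (r t)) has_vector_derivative w) (at 0)"
        unfolding w_def using dr[of 0] q(2)
        by - (rule has_vector_derivative_compose, simp_all add: r0)
      then have "((\<lambda>t. Z t $ i) has_vector_derivative W i) (at 0)" for i
        using line by (simp add: Z_def W_def)
      moreover have Z0: "Z 0 $ i = x $ i" for i using V False by (simp add: Z_def r0)
      ultimately have "((\<lambda>t. f (Z t $ i)) has_vector_derivative grad f (x $ i) \<bullet> W i) (at 0)" for i
        using has_vector_derivative_compose[OF _ has_derivative_grad[OF f]] by metis
      then have deriv: "((\<lambda>t. \<Sum>i\<in>UNIV. b i \<theta> * f (Z t $ i)) has_derivative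
          (\<lambda>s. s *\<^sub>R (\<Sum>i\<in>UNIV. b i \<theta> * (grad f (x $ i) \<bullet> W i)))) (at 0)"
        unfolding has_vector_derivative_def[symmetric]
        by (intro has_vector_derivative_sum has_vector_derivative_mult_right)
      \<comment> \<open>The curve is known to be feasible only while \<open>r t\<close> stays in
        \<open>V\<close>. This is an open neighbourhood of 0, which suffices for a local
        minimum.\<close>
      have "open (r -` V)"
        using dr by (intro open_vimage V continuous_at_imp_continuous_on)
          (auto intro: has_vector_derivative_continuous)
      moreover have "0 \<in> r -` V" using V by (simp add: r0)
      moreover have "\<forall>t\<in>r -` V. (\<Sum>i\<in>UNIV. b i \<theta> * f (Z 0 $ i)) \<le> (\<Sum>i\<in>UNIV. b i \<theta> * f (Z t $ i))"
      proof
        fix t assume that: "t \<in> r -` V"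
        have "h i (Z t $ i) = h i (x $ i) + (if i = k then r t - h k (x $ k) else 0)
            + (if i = m then h m (x $ m + t *\<^sub>R v) - h m (x $ m) else 0)" for i
          using q(1) that False by (simp add: Z_def)
        then have "(\<Sum>i\<in>UNIV. h i (Z t $ i)) = u"
          by (simp add: sum.distrib feas r_def)
        then show "(\<Sum>i\<in>UNIV. b i \<theta> * f (Z 0 $ i)) \<le> (\<Sum>i\<in>UNIV. b i \<theta> * f (Z t $ i))"
          using opt Z0 by simp
      qed
      ultimately have "(\<lambda>s. s *\<^sub>R (\<Sum>i\<in>UNIV. b i \<theta> * (grad f (x $ i) \<bullet> W i))) = (\<lambda>s. 0)"
        using differential_zero_maxmin[OF _ _ deriv] by blast
      then have "(\<Sum>i\<in>UNIV. b i \<theta> * (grad f (x $ i) \<bullet> W i)) = 0"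
        by (metis scaleR_one)
      moreover have "b i \<theta> * (grad f (x $ i) \<bullet> W i) =
          (if i = k then b k \<theta> * (grad f (x $ k) \<bullet> w) else 0) +
          (if i = m then b m \<theta> * (grad f (x $ m) \<bullet> v) else 0)" for i
        using False by (simp add: W_def)
      ultimately have main: "(b k \<theta> *\<^sub>R grad f (x $ k)) \<bullet> w + (b m \<theta> *\<^sub>R grad f (x $ m)) \<bullet> v = 0"
        by (simp add: sum.distrib)
      \<comment> \<open>Stationarity of block \<open>k\<close> replaces its gradient by
        \<open>l\<close>, and \<open>q(3)\<close> cancels the Jacobian against \<open>q'\<close>.
        The term of block \<open>k\<close> becomes the constraint force on block
        \<open>m\<close>.\<close>
      have adj: "(A *v l) \<bullet> y = l \<bullet> (transpose A *v y)" for A :: "real^'n^'n" and y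
        by (metis dot_lmul_matrix transpose_matrix_vector transpose_transpose)
      have "(b k \<theta> *\<^sub>R grad f (x $ k)) \<bullet> w = - ((Jt (h k) (x $ k) *v l) \<bullet> w)"
        using lk by (metis add_eq_0_iff2 inner_minus_left)
      also have "\<dots> = (Jt (h m) (x $ m) *v l) \<bullet> v"
        by (simp add: adj w_def q(3) del: transpose_matrix_vector)
      finally show ?thesis using main by (simp add: inner_add_left)
    qed
    then show ?thesis by (metis inner_eq_zero_iff)
  qed (use lk in simp)
  then show ?thesis using feas by (auto simp: KKT_def)
qed

section \<open>The velocity formula and the equivalence with the conditions\<close>

text \<open>The gradient terms on the two sides cancel because \<open>b m \<theta>\<close> is
  nonzero, leaving a linear system for \<open>v\<close> with matrix \<open>HL\<close>. Stationarity
  is not assumed, so the formula can also be read off the solution set.\<close>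

lemma eq_phi_iff:
  assumes nz: "b m \<theta> \<noteq> 0" and H: "invertible (HL f h b \<theta> x lam m)"
  shows "v = phi \<tau> f h b \<theta> x lam lamdot m \<longleftrightarrow>
    dot \<tau> (b m) \<theta> *\<^sub>R grad f (x $ m) + HL f h b \<theta> x lam m *v v + Jt (h m) (x $ m) *v lamdot =
    (dot \<tau> (b m) \<theta> / b m \<theta>) *\<^sub>R (b m \<theta> *\<^sub>R grad f (x $ m) + Jt (h m) (x $ m) *v lam)"
    (is "_ \<longleftrightarrow> ?eq")
proof -
  let ?J = "Jt (h m) (x $ m)" and ?c = "dot \<tau> (b m) \<theta> / b m \<theta>"
  have "?J *v (lamdot - ?c *\<^sub>R lam) = ?J *v lamdot - ?c *\<^sub>R (?J *v lam)"
    by (simp add: linear_diff[OF matrix_vector_mul_linear] linear_scale[OF matrix_vector_mul_linear])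
  then have "?eq \<longleftrightarrow> HL f h b \<theta> x lam m *v v = - (?J *v (lamdot - ?c *\<^sub>R lam))"
    using nz by (simp add: scaleR_add_right) (auto simp: algebra_simps)
  then show ?thesis
    by (simp add: invertible_mult_eq_iff[OF H] phi_def linear_neg[OF matrix_vector_mul_linear])
qed

theorem proposition1:
  fixes \<tau> :: real and u :: "real^'n"
    and f :: "real^'n \<Rightarrow> real"
    and h :: "'m::finite \<Rightarrow> real^'n \<Rightarrow> real^'n"
    and b :: "'m \<Rightarrow> real \<Rightarrow> real"
    and p0 p\<tau> :: "'m \<Rightarrow> real"
    and x :: "real \<Rightarrow> real^'n^'m" and lam :: "real \<Rightarrow> real^'n"
  assumes "\<tau> > 0"
    and "twice_cont_diff f"
    and "\<And>m n. twice_cont_diff (\<lambda>y. h m y $ n)"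
    and "\<And>m. p0 m \<noteq> 0" and "\<And>m. (b m \<longlongrightarrow> p0 m) (at_right 0)"
    and "\<And>m. p\<tau> m \<noteq> 0" and "\<And>m. (b m \<longlongrightarrow> p\<tau> m) (at_left \<tau>)"
    and "\<And>m \<theta>. \<theta> \<in> {0..\<tau>} \<Longrightarrow> b m differentiable (at \<theta> within {0..\<tau>})"
    and "\<And>m \<theta>. \<theta> \<in> {0<..<\<tau>} \<Longrightarrow> b m \<theta> \<noteq> 0"
    and "\<And>m \<theta>. \<theta> \<in> {0..\<tau>} \<Longrightarrow> invertible (Jt (h m) (x \<theta> $ m))"
    and "\<And>m \<theta>. \<theta> \<in> {0..\<tau>} \<Longrightarrow> invertible (HL f h b \<theta> (x \<theta>) (lam \<theta>) m)"
  shows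
    "((solves_P1 f h b u 0 (x 0) \<or> (\<exists>l. KKT f h b u 0 (x 0) l)) \<longrightarrow>
       (\<forall>k lamdot. follows_system \<tau> f h b k x lam lamdot \<longrightarrow>
          (\<forall>\<theta>\<in>{0..\<tau>}. KKT f h b u \<theta> (x \<theta>) (lam \<theta>) \<and>
             (lam has_vector_derivative lamdot \<theta>) (at \<theta> within {0..\<tau>})))) \<and>
     ((\<forall>\<theta>\<in>{0..\<tau>}. KKT f h b u \<theta> (x \<theta>) (lam \<theta>) \<and> x differentiable (at \<theta> within {0..\<tau>})) \<longrightarrow>
       (\<exists>lamdot. (\<forall>\<theta>\<in>{0..\<tau>}. (lam has_vector_derivative lamdot \<theta>) (at \<theta> within {0..\<tau>})) \<and>
          (\<forall>k. follows_system \<tau> f h b k x lam lamdot)))"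
proof -
  let ?S = "{0..\<tau>}"
  note f = assms(2) and h = assms(3) and b_diff = assms(8)
    and J_inv = assms(10) and H_inv = assms(11)
  have unique: "v = w" if "(g has_vector_derivative v) (at \<theta> within ?S)"
    "(g has_vector_derivative w) (at \<theta> within ?S)" "\<theta> \<in> ?S" for g :: "real \<Rightarrow> real^'n" and v w \<theta>
    using vector_derivative_within_closed_interval[OF \<open>\<tau> > 0\<close>] that by metis
  have const: "g \<theta> = g 0" if "\<And>t. t \<in> ?S \<Longrightarrow> (g has_vector_derivative 0) (at t within ?S)" "\<theta> \<in> ?S"
    for g :: "real \<Rightarrow> real^'n" and \<theta>
    using has_derivative_zero_unique[of ?S g \<theta> 0] that \<open>\<tau> > 0\<close>
    by (simp add: has_vector_derivative_def)
  have db: "(b m has_vector_derivative dot \<tau> (b m) \<theta>) (at \<theta> within ?S)" if "\<theta> \<in> ?S" for m \<theta>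
    unfolding dot_def using b_diff[OF that] by (simp add: vector_derivative_works)
  have b_lim: "(b m \<longlongrightarrow> b m \<theta>) (at \<theta> within ?S)" if "\<theta> \<in> ?S" for m \<theta>
    using differentiable_imp_continuous_within[OF b_diff[OF that]] by (simp add: continuous_within)
  \<comment> \<open>Differentiability makes \<open>b m\<close> continuous at the endpoints, so its
    values there are the prescribed nonzero limits.\<close>
  have b0: "b m 0 \<noteq> 0" for m
    using b_lim[of 0 m] \<open>\<tau> > 0\<close> assms(4,5)[of m] tendsto_unique[OF trivial_limit_at_right_real]
    by (metis at_within_Icc_at_right atLeastAtMost_iff less_eq_real_def)
  have b\<tau>: "b m \<tau> \<noteq> 0" for m
    using b_lim[of \<tau> m] \<open>\<tau> > 0\<close> assms(6,7)[of m] tendsto_unique[OF trivial_limit_at_left_real]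
    by (metis at_within_Icc_at_left atLeastAtMost_iff less_eq_real_def)
  have b_nz: "b m \<theta> \<noteq> 0" if "\<theta> \<in> ?S" for m \<theta>
    using that b0 b\<tau> assms(9)[of \<theta> m] by (cases "\<theta> = 0 \<or> \<theta> = \<tau>") auto
  define r where "r m t = b m t *\<^sub>R grad f (x t $ m) + Jt (h m) (x t $ m) *v lam t" for m t
  \<comment> \<open>The arguments \<open>v\<close> and \<open>l\<close> are kept free so that
    \<open>r'\<close> can be evaluated both at the true derivative of \<open>lam\<close> and at a
    candidate \<open>lamdot\<close>.\<close>
  define r' where "r' m t v l = dot \<tau> (b m) t *\<^sub>R grad f (x t $ m)
    + HL f h b t (x t) (lam t) m *v v + Jt (h m) (x t $ m) *v l" for m t v l
  have dr: "(r m has_vector_derivative r' m t v l) (at t within ?S)"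
    if "((\<lambda>t. x t $ m) has_vector_derivative v) (at t within ?S)"
      "(lam has_vector_derivative l) (at t within ?S)" "t \<in> ?S" for m t v l
    unfolding r_def r'_def by (rule has_vector_derivative_stationarity[OF that(1) db[OF that(3)] that(2) f h])
  have phi_iff: "v = phi \<tau> f h b t (x t) (lam t) l m \<longleftrightarrow> r' m t v l = (dot \<tau> (b m) t / b m t) *\<^sub>R r m t"
    if "t \<in> ?S" for m t v l
    unfolding r_def r'_def using eq_phi_iff[OF b_nz H_inv] that by blast
  have r0_iff: "r m t = 0 \<longleftrightarrow> lam t = multiplier f h b t (x t) m" if "t \<in> ?S" for m t
    unfolding r_def using multiplier_eq_iff[of h m "x t"] J_inv that by blast
  have KKT_iff: "KKT f h b u t (x t) (lam t) \<longleftrightarrow> (\<forall>m. r m t = 0) \<and> (\<Sum>m\<in>UNIV. h m (x t $ m)) = u" for t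
    by (simp add: KKT_def r_def)
  \<comment> \<open>One vanishing residual is enough: it identifies \<open>lam\<close> with the
    multiplier formula of that block.\<close>
  have lam_deriv: "(lam has_vector_derivative vector_derivative lam (at t within ?S)) (at t within ?S)"
    if "\<And>s. s \<in> ?S \<Longrightarrow> r k s = 0" "(\<lambda>t. x t $ k) differentiable (at t within ?S)" "t \<in> ?S" for k t
  proof -
    have "lam differentiable (at t within ?S)"
      using that(1) r0_iff
      by (intro multiplier_differentiable[where h = h, OF that(2) b_diff[OF that(3)] f h J_inv _ that(3)])
        simp_all
    then show ?thesis by (simp add: vector_derivative_works)
  qed
  have r_zero: "r' m t v l = 0"
    if "((\<lambda>t. x t $ m) has_vector_derivative v) (at t within ?S)"
      "(lam has_vector_derivative l) (at t within ?S)" "t \<in> ?S" "\<And>s. s \<in> ?S \<Longrightarrow> r m s = 0" for m t v l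
  proof -
    have "((\<lambda>s. 0) has_vector_derivative r' m t v l) (at t within ?S)"
      using has_vector_derivative_transform[OF _ _ dr[OF that(1-3)], of "\<lambda>s. 0"] that(3,4) by simp
    then show ?thesis using unique[OF _ has_vector_derivative_const] that(3) by blast
  qed
  have dh: "((\<lambda>t. \<Sum>m\<in>UNIV. h m (x t $ m)) has_vector_derivative
      (\<Sum>m\<in>UNIV. transpose (Jt (h m) (x t $ m)) *v dot \<tau> (\<lambda>t. x t $ m) t)) (at t within ?S)"
    if "\<And>m. (\<lambda>t. x t $ m) differentiable (at t within ?S)" for t
    unfolding dot_def using that
    by (intro has_vector_derivative_sum has_vector_derivative_compose[OF _
      has_derivative_Jt[OF differentiable_components[OF h]]]) (simp add: vector_derivative_works)
  show ?thesis
  proof (intro conjI impI allI)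
    fix k lamdot
    assume "solves_P1 f h b u 0 (x 0) \<or> (\<exists>l. KKT f h b u 0 (x 0) l)"
      and sys: "follows_system \<tau> f h b k x lam lamdot"
    then obtain l where l: "KKT f h b u 0 (x 0) l"
      using solves_P1_imp_KKT[of f h "x 0" b u 0] f h J_inv[of 0] \<open>\<tau> > 0\<close>
      by (auto simp: twice_cont_diff_def)
    have dx: "((\<lambda>t. x t $ m) has_vector_derivative phi \<tau> f h b t (x t) (lam t) (lamdot t) m) (at t within ?S)"
      and rk: "r k t = 0"
      and Jx: "(\<Sum>m\<in>UNIV. transpose (Jt (h m) (x t $ m)) *v dot \<tau> (\<lambda>t. x t $ m) t) = 0"
      if "t \<in> ?S" for t m
      using sys that unfolding follows_system_def r0_iff[OF that] by blast+
    have x_diff: "(\<lambda>t. x t $ m) differentiable (at t within ?S)" if "t \<in> ?S" for m t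
      using dx[OF that] by (rule differentiableI_vector)
    have dlam: "(lam has_vector_derivative lamdot t) (at t within ?S)" if t: "t \<in> ?S" for t
    proof -
      \<comment> \<open>Both evaluations of \<open>r' k\<close> at the velocity \<open>?v\<close>
        vanish: with \<open>?l\<close> because \<open>r k\<close> is identically 0, with
        \<open>lamdot t\<close> by the velocity formula. They differ only in the \<open>Jt\<close>
        term.\<close>
      let ?l = "vector_derivative lam (at t within ?S)" and ?v = "phi \<tau> f h b t (x t) (lam t) (lamdot t) k"
      have "r' k t ?v ?l = 0" using r_zero[OF dx lam_deriv] x_diff rk t by blast
      moreover have "r' k t ?v (lamdot t) = 0" using phi_iff[OF t, of ?v "lamdot t" k] rk[OF t] by simp
      ultimately have "Jt (h k) (x t $ k) *v ?l = Jt (h k) (x t $ k) *v lamdot t"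
        by (simp add: r'_def) (metis add_left_cancel)
      then have "?l = lamdot t" using invertible_mult_eq_iff[OF J_inv[OF t]] by metis
      then show ?thesis using lam_deriv[of k t] rk x_diff[OF t] t by auto
    qed
    \<comment> \<open>The initial condition provides some multiplier \<open>l\<close>, not a priori
      \<open>lam 0\<close>. Invertibility of \<open>Jt\<close> for block \<open>k\<close> forces the
      two to agree.\<close>
    have r_init: "r m 0 = 0" for m
    proof -
      have "l = multiplier f h b 0 (x 0) k"
        using l multiplier_eq_iff[of h k "x 0"] J_inv[of 0] \<open>\<tau> > 0\<close> unfolding KKT_def by fastforce
      then have "lam 0 = l" using rk[of 0] r0_iff[of 0] \<open>\<tau> > 0\<close> by simp
      then show ?thesis using l by (simp add: KKT_def r_def)
    qed
    have "r m t = 0" if t: "t \<in> ?S" for m t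
    proof -
      \<comment> \<open>Integrating factor for the linear equation that \<open>dr\<close> and
        \<open>phi_iff\<close> give for \<open>r m\<close>.\<close>
      have "((\<lambda>s. inverse (b m s) *\<^sub>R r m s) has_vector_derivative 0) (at s within ?S)" if s: "s \<in> ?S" for s
      proof -
        have "(r m has_vector_derivative (dot \<tau> (b m) s / b m s) *\<^sub>R r m s) (at s within ?S)"
          using dr[OF dx dlam] phi_iff s by metis
        moreover have "((\<lambda>s. inverse (b m s)) has_real_derivative
            - (inverse (b m s) * dot \<tau> (b m) s * inverse (b m s))) (at s within ?S)"
          using db[OF s] b_nz[OF s]
          by (intro DERIV_inverse') (simp_all add: has_real_derivative_iff_has_vector_derivative)
        ultimately show ?thesis
          using has_vector_derivative_scaleR by (force simp: divide_inverse mult_ac)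
      qed
      from const[OF this t] show ?thesis using r_init b_nz[OF t] by simp
    qed
    moreover have "(\<Sum>m\<in>UNIV. h m (x t $ m)) = u" if "t \<in> ?S" for t
    proof -
      \<comment> \<open>The last equation of the system says that the constraint map has zero
        derivative along the trajectory, so its initial value \<open>u\<close> persists.\<close>
      have "((\<lambda>t. \<Sum>m\<in>UNIV. h m (x t $ m)) has_vector_derivative 0) (at s within ?S)" if "s \<in> ?S" for s
        using dh[OF x_diff[OF that]] by (simp only: Jx[OF that])
      then have "(\<Sum>m\<in>UNIV. h m (x t $ m)) = (\<Sum>m\<in>UNIV. h m (x 0 $ m))"
        using that by (rule const)
      then show ?thesis using l by (simp add: KKT_def)
    qed
    ultimately show "\<forall>\<theta>\<in>?S. KKT f h b u \<theta> (x \<theta>) (lam \<theta>) \<and>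
        (lam has_vector_derivative lamdot \<theta>) (at \<theta> within ?S)"
      using dlam by (simp add: KKT_iff)
  next
    assume A: "\<forall>\<theta>\<in>?S. KKT f h b u \<theta> (x \<theta>) (lam \<theta>) \<and> x differentiable (at \<theta> within ?S)"
    then have r: "r m t = 0" and c: "(\<Sum>m\<in>UNIV. h m (x t $ m)) = u" if "t \<in> ?S" for m t
      using that by (auto simp: KKT_iff)
    have x_diff: "(\<lambda>t. x t $ m) differentiable (at t within ?S)" if "t \<in> ?S" for m t
      using A that unfolding differentiable_def
      by (blast intro: bounded_linear.has_derivative[OF bounded_linear_vec_nth])
    then have dx: "((\<lambda>t. x t $ m) has_vector_derivative dot \<tau> (\<lambda>t. x t $ m) t) (at t within ?S)"
      if "t \<in> ?S" for m t
      using that by (simp add: dot_def vector_derivative_works)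
    define lamdot where "lamdot t = vector_derivative lam (at t within ?S)" for t
    have dlam: "(lam has_vector_derivative lamdot t) (at t within ?S)" if "t \<in> ?S" for t
      unfolding lamdot_def using lam_deriv r x_diff that by blast
    \<comment> \<open>Since \<open>r m\<close> is identically 0, both sides of the equation in
      \<open>phi_iff\<close> vanish at the actual velocity.\<close>
    have vel: "dot \<tau> (\<lambda>t. x t $ m) t = phi \<tau> f h b t (x t) (lam t) (lamdot t) m" if t: "t \<in> ?S" for m t
      using r_zero[OF dx[OF t] dlam[OF t] t] r t by (simp add: phi_iff)
    have Jx: "(\<Sum>m\<in>UNIV. transpose (Jt (h m) (x t $ m)) *v dot \<tau> (\<lambda>t. x t $ m) t) = 0"
      if t: "t \<in> ?S" for t
    proof -
      \<comment> \<open>The constraint value is the constant \<open>u\<close> on the interval, so by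
        uniqueness its chain-rule derivative is 0.\<close>
      have "((\<lambda>t. u) has_vector_derivative
          (\<Sum>m\<in>UNIV. transpose (Jt (h m) (x t $ m)) *v dot \<tau> (\<lambda>t. x t $ m) t)) (at t within ?S)"
        using has_vector_derivative_transform[OF t _ dh[OF x_diff[OF t]], of "\<lambda>t. u"] c by simp
      then show ?thesis using unique[OF _ has_vector_derivative_const t] by blast
    qed
    have "follows_system \<tau> f h b k x lam lamdot" for k
      unfolding follows_system_def
    proof (intro ballI conjI allI)
      fix t m assume t: "t \<in> ?S"
      show "((\<lambda>t. x t $ m) has_vector_derivative phi \<tau> f h b t (x t) (lam t) (lamdot t) m) (at t within ?S)"
        using dx[OF t] by (simp only: vel[OF t])
      show "lam t = multiplier f h b t (x t) k" using r r0_iff t by blast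
    qed (rule Jx)
    then show "\<exists>lamdot. (\<forall>\<theta>\<in>?S. (lam has_vector_derivative lamdot \<theta>) (at \<theta> within ?S)) \<and>
        (\<forall>k. follows_system \<tau> f h b k x lam lamdot)"
      using dlam by blast
  qed
qed

end
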